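(* Let $x\mapsto (Ax,x)$ be a positive definite quadratic form on the space $\mathbb{R}^{N^2}$ of real $N\times N$ matrices, let $f$ be a real $N\times N$ matrix, let $p\neq0$ be real, and let $$\Phi(x)=\frac12(Ax,x)-\frac{N}{p}\,|\det x|^{p/N}-(f,x).$$ If $p<2$, there is at least one critical point for $\Phi$, i.e. a matrix $x$ with $\Phi'(x)=0$.
   Context: $(\cdot,\cdot)$ is the standard entrywise inner product on the space $\mathbb{R}^{N^2}$ of real $N\times N$ matrices, and $A:\mathbb{R}^{N^2}\to\mathbb{R}^{N^2}$ is the symmetric positive definite linear operator representing the quadratic form. A critical point of $\Phi$ is a point $x$ at which $\Phi$ is differentiable with $\Phi'(x)=0$. When $p<0$, $\Phi$ is considered on the set of matrices with $\det x\neq0$, where the formula makes sense. *)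

theory Defs
  imports "HOL-Analysis.Analysis"
begin

definition sym_pos_def_operator :: "('a::real_inner \<Rightarrow> 'a) \<Rightarrow> bool" where
  "sym_pos_def_operator A \<longleftrightarrow>
     linear A \<and> (\<forall>x y. A x \<bullet> y = x \<bullet> A y) \<and> (\<forall>x. x \<noteq> 0 \<longrightarrow> A x \<bullet> x > 0)"

(* The library inner product on real^'n^'n is the entrywise one; the size N is CARD('n).
   Since 0 powr a = 0, the determinant term vanishes at singular x. For p > 0 this is the
   intended value; for p < 0 it is a junk value, excluded by Phi_domain. *)
definition Phi :: "(real^'n^'n \<Rightarrow> real^'n^'n) \<Rightarrow> real^'n^'n \<Rightarrow> real \<Rightarrow> real^'n^'n \<Rightarrow> real" where
  "Phi A f p x =
     1 / 2 * (A x \<bullet> x)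
     - real CARD('n) / p * \<bar>det x\<bar> powr (p / real CARD('n))
     - f \<bullet> x"

definition Phi_domain :: "real \<Rightarrow> (real^'n^'n) set" where
  "Phi_domain p = (if p < 0 then {x. det x \<noteq> 0} else UNIV)"

(* Meant for open D, so that the unrestricted derivative at a point of D only depends on
   the values of F on D. *)
definition critical_point_on :: "'a::real_normed_vector set \<Rightarrow> ('a \<Rightarrow> real) \<Rightarrow> 'a \<Rightarrow> bool" where
  "critical_point_on D F x \<longleftrightarrow> x \<in> D \<and> (F has_derivative (\<lambda>h. 0)) (at x)"

end

theory Submission
  imports Defs "HOL-Computational_Algebra.Fundamental_Theorem_Algebra"
begin

text \<open>
  A global minimum point of \<open>\<Phi>\<close> exists, because the quadratic form dominates
  \<open>\<bar>det x\<bar> powr (p/N) = O(\<bar>x\<bar> powr p)\<close> when \<open>0 < p < 2\<close>, and because the determinant term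
  tends to \<open>+\<infinity>\<close> at singular matrices when \<open>p < 0\<close>. Where \<open>det x \<noteq> 0\<close> the functional is
  differentiable, so it remains to see that for \<open>0 < p < 2\<close> a singular matrix \<open>x\<close> is never a
  minimum point. In the second difference \<open>\<Phi>(x + tI) + \<Phi>(x - tI) - 2\<Phi>(x)\<close> the linear terms
  cancel, the quadratic form contributes a multiple of \<open>t\<^sup>2\<close>, and the determinant term at most
  \<open>-(2N/p) \<bar>t\<bar> powr p\<close>, since \<open>\<bar>det (x + tI)\<bar> \<ge> \<bar>t\<bar>^N\<close> for small \<open>t\<close>; as \<open>p < 2\<close> the sum is negative.
\<close>

section \<open>Estimates for the quadratic form and the determinant\<close>

text \<open>The constant is the minimum of the form on the compact unit sphere; homogeneity of
  degree 2 carries the bound to all vectors.\<close>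

lemma positive_definite_lower_bound:
  fixes A :: "'a::euclidean_space \<Rightarrow> 'a"
  assumes lin: "linear A" and pos: "\<And>x. x \<noteq> 0 \<Longrightarrow> A x \<bullet> x > 0"
  obtains a where "a > 0" "\<And>x. a * (norm x)\<^sup>2 \<le> A x \<bullet> x"
proof -
  let ?S = "sphere (0::'a) 1"
  have cont: "continuous_on ?S (\<lambda>x. A x \<bullet> x)"
    by (intro continuous_intros linear_continuous_on linear_conv_bounded_linear[THEN iffD1] lin)
  have ne: "?S \<noteq> {}"
    by simp
  obtain u where u: "u \<in> ?S" "\<And>x. x \<in> ?S \<Longrightarrow> A u \<bullet> u \<le> A x \<bullet> x"
    using continuous_attains_inf[OF compact_sphere ne cont] by blast
  show thesis
  proof
    show "A u \<bullet> u > 0"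
      using u(1) by (intro pos) auto
    show "A u \<bullet> u * (norm x)\<^sup>2 \<le> A x \<bullet> x" for x
    proof (cases "x = 0")
      case False
      then have "A u \<bullet> u \<le> A (x /\<^sub>R norm x) \<bullet> (x /\<^sub>R norm x)"
        by (intro u(2)) simp
      also have "\<dots> = A x \<bullet> x / (norm x)\<^sup>2"
        by (simp add: linear_scale[OF lin] divide_inverse power2_eq_square)
      finally show ?thesis
        using False by (simp add: field_simps)
    qed (simp add: linear_0[OF lin])
  qed
qed

lemma det_scaleR:
  fixes x :: "real^'n^'n"
  shows "det (t *\<^sub>R x) = t ^ CARD('n) * det x"
  by (simp add: det_def prod.distrib sum_distrib_left mult_ac)

text \<open>The Leibniz formula has N! terms, each a product of N entries of size at most
  \<open>norm x\<close>.\<close>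

lemma abs_det_le:
  fixes x :: "real^'n^'n"
  shows "\<bar>det x\<bar> \<le> fact CARD('n) * norm x ^ CARD('n)"
proof -
  have entry: "\<bar>x $ i $ j\<bar> \<le> norm x" for i j
    using component_le_norm_cart[where x = "x $ i" and i = j] Finite_Cartesian_Product.norm_nth_le[where x = x and i = i] by linarith
  have "\<bar>det x\<bar> \<le> (\<Sum>\<sigma> | \<sigma> permutes (UNIV::'n set). norm x ^ CARD('n))"
    unfolding det_def
  proof (rule order_trans[OF sum_abs], rule sum_mono)
    fix \<sigma> :: "'n \<Rightarrow> 'n"
    have "\<bar>of_int (sign \<sigma>) * (\<Prod>i\<in>UNIV. x $ i $ \<sigma> i)\<bar> = (\<Prod>i\<in>UNIV. \<bar>x $ i $ \<sigma> i\<bar>)"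
      by (simp add: abs_mult abs_prod sign_def)
    also have "\<dots> \<le> (\<Prod>i\<in>(UNIV::'n set). norm x)"
      by (intro prod_mono) (simp add: entry)
    finally show "\<bar>of_int (sign \<sigma>) * (\<Prod>i\<in>UNIV. x $ i $ \<sigma> i)\<bar> \<le> norm x ^ CARD('n)"
      by simp
  qed
  then show ?thesis
    by (simp add: card_permutations[OF refl])
qed

lemma differentiable_det:
  "(det :: real^'n^'n \<Rightarrow> real) differentiable (at x)"
  unfolding det_def[abs_def] differentiable_def
  by (rule exI)
    (rule has_derivative_sum has_derivative_mult_right has_derivative_prod
      bounded_linear_imp_has_derivative bounded_linear_vec_nth
      bounded_linear.has_derivative[OF bounded_linear_vec_nth] has_derivative_ident)+

lemma continuous_on_det:
  "continuous_on S (det :: real^'n^'n \<Rightarrow> real)"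
  by (rule continuous_on_subset[OF _ subset_UNIV])
    (simp add: continuous_at_imp_continuous_on differentiable_imp_continuous_within differentiable_det)

text \<open>
  The rescaled determinant \<open>det (I + s x)\<close> is a polynomial in \<open>s\<close> with value 1 at 0; it is either
  constant or unbounded at infinity.
\<close>
lemma abs_det_add_scaled_identity_ge:
  fixes x :: "real^'n^'n"
  obtains d where "d > 0" "\<And>t. 0 < \<bar>t\<bar> \<Longrightarrow> \<bar>t\<bar> < d \<Longrightarrow> \<bar>t\<bar> ^ CARD('n) \<le> \<bar>det (x + t *\<^sub>R mat 1)\<bar>"
proof -
  \<comment> \<open>Leibniz formula for \<open>mat 1 + s *\<^sub>R x\<close>, with every entry
    written as a polynomial of degree at most 1 in \<open>s\<close>.\<close>
  define P where "P = (\<Sum>\<sigma> | \<sigma> permutes (UNIV::'n set).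
    of_int (sign \<sigma>) * (\<Prod>i\<in>UNIV. [:(mat 1 :: real^'n^'n) $ i $ \<sigma> i, x $ i $ \<sigma> i:]))"
  have P: "poly P s = det (mat 1 + s *\<^sub>R x)" for s
    by (simp add: P_def det_def poly_sum poly_prod)
  obtain c q where cq: "P = pCons c q"
    by (cases P)
  have c: "c = 1"
    using P[of 0] cq by (simp add: det_I)
  have "\<exists>r. \<forall>s. r \<le> norm s \<longrightarrow> 1 \<le> norm (poly P s)"
  proof (cases "q = 0")
    case False
    then show ?thesis
      unfolding cq by (rule poly_infinity)
  qed (simp add: cq c)
  then obtain r where r: "\<And>s. r \<le> \<bar>s\<bar> \<Longrightarrow> 1 \<le> \<bar>poly P s\<bar>"
    by auto
  show thesis
  proof
    \<comment> \<open>With \<open>s = 1 / t\<close>, this radius forces \<bar>s\<bar> > r, and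
      \<open>x + t *\<^sub>R mat 1\<close> is t times \<open>mat 1 + s *\<^sub>R x\<close>.\<close>
    show "1 / (\<bar>r\<bar> + 1) > 0"
      by simp
    fix t :: real
    assume t: "0 < \<bar>t\<bar>" "\<bar>t\<bar> < 1 / (\<bar>r\<bar> + 1)"
    then have "(\<bar>r\<bar> + 1) * \<bar>t\<bar> < 1"
      by (simp add: field_simps)
    then have "\<bar>r\<bar> + 1 < \<bar>1 / t\<bar>"
      using t(1) by (simp add: field_simps)
    then have "1 \<le> \<bar>det (mat 1 + (1 / t) *\<^sub>R x)\<bar>"
      using r[of "1 / t"] by (simp add: P)
    moreover have "x + t *\<^sub>R mat 1 = t *\<^sub>R (mat 1 + (1 / t) *\<^sub>R x)"
      using t(1) by (simp add: scaleR_right_distrib)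
    then have "\<bar>det (x + t *\<^sub>R mat 1)\<bar> = \<bar>t\<bar> ^ CARD('n) * \<bar>det (mat 1 + (1 / t) *\<^sub>R x)\<bar>"
      by (simp only: det_scaleR abs_mult power_abs)
    ultimately show "\<bar>t\<bar> ^ CARD('n) \<le> \<bar>det (x + t *\<^sub>R mat 1)\<bar>"
      by (simp add: mult_le_cancel_left1)
  qed
qed

lemma power_powr_divide:
  assumes "r > 0" "n > 0"
  shows "(r ^ n) powr (p / real n) = r powr p"
  using assms by (simp add: powr_realpow[symmetric] powr_powr)

section \<open>Differentiability and coercivity of the functional\<close>

lemma Phi_differentiable:
  fixes x :: "real^'n^'n"
  assumes lin: "linear A" and x: "det x \<noteq> 0"
  shows "Phi A f p differentiable (at x)"
proof -
  obtain D where D: "(det has_derivative D) (at x)"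
    using differentiable_det[of x] unfolding differentiable_def by blast
  have A: "(A has_derivative A) (at x)"
    by (rule bounded_linear_imp_has_derivative)
      (use lin in \<open>simp add: linear_conv_bounded_linear\<close>)
  \<comment> \<open>In this form the chain rule for \<open>sqrt\<close> handles the absolute value,
    as the radicand is positive at \<open>x\<close>.\<close>
  have abs_det: "\<bar>det y\<bar> = sqrt ((det y)\<^sup>2)" for y :: "real^'n^'n"
    by simp
  have "\<exists>E. ((\<lambda>y. sqrt ((det y)\<^sup>2) powr (p / real CARD('n))) has_derivative E) (at x)"
    by (rule exI) (rule derivative_eq_intros D refl | use x in simp)+
  then obtain E where E: "((\<lambda>y. \<bar>det y\<bar> powr (p / real CARD('n))) has_derivative E) (at x)"
    unfolding abs_det by blast
  show ?thesis
    unfolding Phi_def[abs_def] differentiable_def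
    by (rule exI) (rule derivative_intros A E)+
qed

lemma Phi_coercive:
  fixes A :: "real^'n^'n \<Rightarrow> real^'n^'n"
  assumes A: "sym_pos_def_operator A" and p: "p \<noteq> 0" "p < 2"
  obtains R where "\<And>x. R \<le> norm x \<Longrightarrow> M < Phi A f p x"
proof -
  obtain a where a: "a > 0" "\<And>x. a * (norm x)\<^sup>2 \<le> A x \<bullet> x"
    using A unfolding sym_pos_def_operator_def by (metis positive_definite_lower_bound)
  let ?N = "real CARD('n)"
  \<comment> \<open>For p < 0 the subtracted determinant term is at most 0, so C = 0 serves;
    otherwise C comes from \<open>abs_det_le\<close> raised to the power p/N.\<close>
  define C where "C = (if p < 0 then 0 else ?N / p * fact CARD('n) powr (p / ?N))"
  have det_term: "?N / p * \<bar>det x\<bar> powr (p / ?N) \<le> C * norm x powr p" if "norm x > 0" for x :: "real^'n^'n"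
  proof (cases "p < 0")
    case True
    then show ?thesis
      by (simp add: C_def divide_nonneg_neg mult_nonpos_nonneg divide_nonneg_nonpos)
  next
    case False
    then have "\<bar>det x\<bar> powr (p / ?N) \<le> (fact CARD('n) * norm x ^ CARD('n)) powr (p / ?N)"
      by (intro powr_mono2 abs_det_le) auto
    also have "\<dots> = fact CARD('n) powr (p / ?N) * norm x powr p"
      using that by (simp add: powr_mult power_powr_divide)
    finally show ?thesis
      using False p by (simp add: C_def field_simps)
  qed
  \<comment> \<open>The lower bound for the functional at norm r, divided by
    \<open>r\<^sup>2\<close>. Since p - 2 < 0, it tends to a/2 > 0.\<close>
  have "((\<lambda>r. a / 2 - C * r powr (p - 2) - norm f * inverse r) \<longlongrightarrow> a / 2 - C * 0 - norm f * 0) at_top"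
    using p by (intro tendsto_intros tendsto_neg_powr filterlim_ident tendsto_inverse_0_at_top) auto
  then have "filterlim (\<lambda>r. (a / 2 - C * r powr (p - 2) - norm f * inverse r) * r\<^sup>2) at_top at_top"
    using a(1) by (intro filterlim_tendsto_pos_mult_at_top[where c = "a / 2"] filterlim_pow_at_top filterlim_ident) auto
  then have "\<forall>\<^sub>F r in at_top. M < (a / 2 - C * r powr (p - 2) - norm f * inverse r) * r\<^sup>2"
    by (simp add: filterlim_at_top_dense)
  then obtain R0 where R0: "\<And>r. R0 \<le> r \<Longrightarrow> M < (a / 2 - C * r powr (p - 2) - norm f * inverse r) * r\<^sup>2"
    unfolding eventually_at_top_linorder by blast
  show thesis
  proof
    fix x :: "real^'n^'n"
    assume "max R0 1 \<le> norm x"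
    then have x: "R0 \<le> norm x" "norm x > 0"
      by auto
    have "norm x powr p = norm x powr (p - 2) * (norm x)\<^sup>2"
      using x(2) by (simp add: powr_diff powr_numeral)
    then have "(a / 2 - C * norm x powr (p - 2) - norm f * inverse (norm x)) * (norm x)\<^sup>2
        = 1 / 2 * (a * (norm x)\<^sup>2) - C * norm x powr p - norm f * norm x"
      using x(2) by (simp add: algebra_simps power2_eq_square)
    also have "\<dots> \<le> Phi A f p x"
      using a(2)[of x] det_term[OF x(2)] norm_cauchy_schwarz[of f x]
      unfolding Phi_def by linarith
    finally show "M < Phi A f p x"
      using R0[OF x(1)] by linarith
  qed
qed

section \<open>Singular matrices for positive exponents\<close>

lemma singular_not_minimum:
  fixes A :: "real^'n^'n \<Rightarrow> real^'n^'n" and f x :: "real^'n^'n"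
  assumes lin: "linear A" and p: "0 < p" "p < 2" and x: "det x = 0"
  obtains y where "Phi A f p y < Phi A f p x"
proof -
  let ?N = "real CARD('n)" and ?I = "mat 1 :: real^'n^'n"
  obtain d where d: "d > 0" "\<And>t. 0 < \<bar>t\<bar> \<Longrightarrow> \<bar>t\<bar> < d \<Longrightarrow> \<bar>t\<bar> ^ CARD('n) \<le> \<bar>det (x + t *\<^sub>R ?I)\<bar>"
    using abs_det_add_scaled_identity_ge[of x] by blast
  \<comment> \<open>The limit is 0 because 0 powr _ = 0. The bound obtained for small t is the
    wanted \<open>t\<^sup>2 * (A ?I \<bullet> ?I) < 2 * c\<close> divided by
    \<open>t powr p\<close>.\<close>
  have "((\<lambda>t. t powr (2 - p) * (A ?I \<bullet> ?I)) \<longlongrightarrow> 0 powr (2 - p) * (A ?I \<bullet> ?I)) (at_right 0)"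
    using p by (intro tendsto_intros tendsto_powr') (auto simp: eventually_at_right_less less_imp_le eventually_mono[OF eventually_at_right_less])
  then have "\<forall>\<^sub>F t in at_right 0. t powr (2 - p) * (A ?I \<bullet> ?I) < 2 * ?N / p"
    using p by (intro order_tendstoD) auto
  moreover have "\<forall>\<^sub>F t in at_right 0. 0 < t \<and> t < d"
    using d(1) by (auto simp: eventually_at_right)
  ultimately have "\<forall>\<^sub>F t in at_right 0. t powr (2 - p) * (A ?I \<bullet> ?I) < 2 * ?N / p \<and> 0 < t \<and> t < d"
    by (rule eventually_conj)
  then obtain t where t: "t powr (2 - p) * (A ?I \<bullet> ?I) < 2 * ?N / p" "0 < t" "t < d"
    using eventually_happens'[OF trivial_limit_at_right_real] by blast
  define c where "c = ?N / p * t powr p"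
  define Q :: "real^'n^'n \<Rightarrow> real" where "Q y = ?N / p * \<bar>det y\<bar> powr (p / ?N)" for y
  have Phi_Q: "Phi A f p y = 1 / 2 * (A y \<bullet> y) - Q y - f \<bullet> y" for y
    by (simp add: Phi_def Q_def)
  have Q_ge: "c \<le> Q (x + s *\<^sub>R ?I)" if "\<bar>s\<bar> = t" for s
  proof -
    have "t powr p = (t ^ CARD('n)) powr (p / ?N)"
      using t(2) by (simp add: power_powr_divide)
    also have "\<dots> \<le> \<bar>det (x + s *\<^sub>R ?I)\<bar> powr (p / ?N)"
      using d(2)[of s] t that p by (intro powr_mono2) auto
    finally show ?thesis
      unfolding Q_def c_def using p by (intro mult_left_mono) auto
  qed
  have "t\<^sup>2 * (A ?I \<bullet> ?I) = t powr p * (t powr (2 - p) * (A ?I \<bullet> ?I))"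
    using t(2) by (simp flip: powr_add powr_numeral)
  also have "\<dots> < t powr p * (2 * ?N / p)"
    using t by (intro mult_strict_left_mono) auto
  finally have small: "t\<^sup>2 * (A ?I \<bullet> ?I) < 2 * c"
    by (simp add: c_def mult_ac)
  define u v where uv: "u = x + t *\<^sub>R ?I" "v = x + (- t) *\<^sub>R ?I"
  have "A u \<bullet> u + A v \<bullet> v = 2 * (A x \<bullet> x) + 2 * (t\<^sup>2 * (A ?I \<bullet> ?I))"
    unfolding uv linear_add[OF lin] linear_scale[OF lin]
    by (simp add: inner_add_left inner_add_right inner_diff_left inner_diff_right power2_eq_square algebra_simps)
  moreover have "f \<bullet> u + f \<bullet> v = 2 * (f \<bullet> x)"
    by (simp add: uv inner_add_right inner_diff_right)
  moreover have "Q x = 0"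
    using x by (simp add: Q_def)
  moreover have "c \<le> Q u" "c \<le> Q v"
    using Q_ge[of t] Q_ge[of "- t"] t(2) by (simp_all add: uv)
  ultimately have "Phi A f p u + Phi A f p v < 2 * Phi A f p x"
    using small unfolding Phi_Q by argo
  \<comment> \<open>Only the average of the two values is known to lie below the value at
    \<open>x\<close>, so the sign of the step stays undetermined.\<close>
  then have "Phi A f p u < Phi A f p x \<or> Phi A f p v < Phi A f p x"
    by linarith
  then show thesis
    using that by blast
qed

section \<open>Existence of a minimum point\<close>

lemma continuous_on_Phi:
  fixes A :: "real^'n^'n \<Rightarrow> real^'n^'n"
  assumes lin: "linear A" and S: "p > 0 \<or> (\<forall>x\<in>S. det x \<noteq> 0)"
  shows "continuous_on S (Phi A f p)"
proof -
  have "continuous_on S (\<lambda>x. \<bar>det x\<bar> powr (p / real CARD('n)))"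
  proof (cases "p > 0")
    case True
    then show ?thesis
      by (intro continuous_on_powr' continuous_intros continuous_on_det) auto
  next
    case False
    then show ?thesis
      using S by (intro continuous_on_powr continuous_intros continuous_on_det) auto
  qed
  moreover have "continuous_on S A"
    by (rule linear_continuous_on) (use lin in \<open>simp add: linear_conv_bounded_linear\<close>)
  ultimately show ?thesis
    unfolding Phi_def[abs_def]
    by (intro continuous_on_diff continuous_on_mult continuous_on_inner continuous_on_const continuous_on_id)
qed

text \<open>On a ball the linear term is bounded and the form is nonnegative, while -N/p > 0
  multiplies a negative power of \<bar>det x\<bar>.\<close>

lemma Phi_large_near_singular:
  fixes A :: "real^'n^'n \<Rightarrow> real^'n^'n"
  assumes A: "sym_pos_def_operator A" and p: "p < 0"
  obtains e where "e > 0"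
    "\<And>x. norm x \<le> R \<Longrightarrow> det x \<noteq> 0 \<Longrightarrow> \<bar>det x\<bar> < e \<Longrightarrow> M < Phi A f p x"
proof -
  let ?N = "real CARD('n)"
  \<comment> \<open>Threshold for \<open>\<bar>det x\<bar> powr (p / ?N)\<close> beyond which the
    value exceeds M. The maximum with 1 keeps b positive, so that b can be recovered from
    \<open>b powr (?N / p)\<close>.\<close>
  define b where "b = max 1 ((M + norm f * R) * (- p / ?N))"
  have b: "b > 0" "(M + norm f * R) * (- p / ?N) \<le> b"
    by (auto simp: b_def)
  show thesis
  proof
    show "b powr (?N / p) > 0"
      using b(1) by simp
    fix x :: "real^'n^'n"
    assume x: "norm x \<le> R" "det x \<noteq> 0" "\<bar>det x\<bar> < b powr (?N / p)"
    have "b = (b powr (?N / p)) powr (p / ?N)"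
      using b(1) p by (simp add: powr_powr)
    also have "\<dots> < \<bar>det x\<bar> powr (p / ?N)"
      using x p by (intro powr_less_mono2_neg) (auto simp: divide_neg_pos)
    finally have "(M + norm f * R) * (- p / ?N) < \<bar>det x\<bar> powr (p / ?N)"
      using b(2) by linarith
    then have "M + norm f * R < - (?N / p * \<bar>det x\<bar> powr (p / ?N))"
      using p by (simp add: field_simps)
    moreover have "f \<bullet> x \<le> norm f * R"
      using norm_cauchy_schwarz[of f x] mult_left_mono[OF x(1), of "norm f"] by simp
    moreover have "A x \<bullet> x \<ge> 0"
      using A unfolding sym_pos_def_operator_def
      by (metis inner_zero_right less_imp_le order_refl)
    ultimately show "M < Phi A f p x"
      unfolding Phi_def by linarith
  qed
qed

text \<open>The identity serves as reference point: on the domain, outside a compact set containing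
  it, the functional exceeds its value there.\<close>

lemma Phi_attains_minimum:
  fixes A :: "real^'n^'n \<Rightarrow> real^'n^'n"
  assumes A: "sym_pos_def_operator A" and p: "p \<noteq> 0" "p < 2"
  obtains z where "z \<in> Phi_domain p" "\<And>y. y \<in> Phi_domain p \<Longrightarrow> Phi A f p z \<le> Phi A f p y"
proof -
  let ?I = "mat 1 :: real^'n^'n"
  have lin: "linear A"
    using A by (simp add: sym_pos_def_operator_def)
  obtain R0 where R0: "\<And>x. R0 \<le> norm x \<Longrightarrow> Phi A f p ?I < Phi A f p x"
    using Phi_coercive[OF A p] by blast
  define R where "R = max R0 (norm ?I)"
  obtain e where e: "p < 0 \<Longrightarrow> e > 0"
    "\<And>x :: real^'n^'n. p < 0 \<Longrightarrow> norm x \<le> R \<Longrightarrow> det x \<noteq> 0 \<Longrightarrow> \<bar>det x\<bar> < e \<Longrightarrow> Phi A f p ?I < Phi A f p x"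
    by (metis Phi_large_near_singular[OF A, where p = p and R = R and f = f and M = "Phi A f p ?I"])
  define K :: "(real^'n^'n) set" where "K = {x \<in> cball 0 R. p < 0 \<longrightarrow> e \<le> \<bar>det x\<bar>}"
  have "compact K"
  proof (cases "p < 0")
    case True
    then have "K = cball 0 R \<inter> {x. e \<le> \<bar>det x\<bar>}"
      by (auto simp: K_def)
    then show ?thesis
      by (auto intro!: compact_Int_closed closed_Collect_le continuous_intros continuous_on_det)
  next
    case False
    then have "K = cball 0 R"
      by (auto simp: K_def)
    then show ?thesis
      by simp
  qed
  moreover have I: "?I \<in> K"
    \<comment> \<open>If p < 0 and \<bar>det I\<bar> < e, the choice of e would make the value at
      the identity smaller than itself.\<close>
    using e(2)[of ?I] by (force simp: K_def R_def not_less[symmetric])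
  moreover have "continuous_on K (Phi A f p)"
    using e(1) p by (intro continuous_on_Phi lin) (force simp: K_def)
  ultimately obtain z where z: "z \<in> K" "\<And>x. x \<in> K \<Longrightarrow> Phi A f p z \<le> Phi A f p x"
    using continuous_attains_inf[of K "Phi A f p"] by blast
  show thesis
  proof
    show "z \<in> Phi_domain p"
      using z(1) e(1) by (auto simp: K_def Phi_domain_def)
    fix y :: "real^'n^'n"
    assume y: "y \<in> Phi_domain p"
    show "Phi A f p z \<le> Phi A f p y"
    proof (cases "y \<in> K")
      case False
      then have "R0 \<le> norm y \<or> (p < 0 \<and> norm y \<le> R \<and> det y \<noteq> 0 \<and> \<bar>det y\<bar> < e)"
        using y by (auto simp: K_def Phi_domain_def R_def split: if_splits)
      then have "Phi A f p ?I < Phi A f p y"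
        using R0 e(2) by blast
      then show ?thesis
        using z(2)[OF I] by linarith
    qed (rule z(2))
  qed
qed

text \<open>Makes a minimum over the domain an interior one, where the derivative must
  vanish.\<close>

lemma open_Phi_domain: "open (Phi_domain p :: (real^'n^'n) set)"
  unfolding Phi_domain_def by (auto intro!: open_Collect_neq continuous_on_det continuous_on_const)

theorem proposition6:
  fixes A :: "real^'n^'n \<Rightarrow> real^'n^'n"
    and f :: "real^'n^'n"
    and p :: real
  assumes "sym_pos_def_operator A"
    and "p \<noteq> 0"
    and "p < 2"
  shows "\<exists>x. critical_point_on (Phi_domain p) (Phi A f p) x"
proof -
  have lin: "linear A"
    using assms(1) by (simp add: sym_pos_def_operator_def)
  obtain z where z: "z \<in> Phi_domain p" "\<And>y. y \<in> Phi_domain p \<Longrightarrow> Phi A f p z \<le> Phi A f p y"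
    using Phi_attains_minimum[OF assms] by blast
  \<comment> \<open>Needed for differentiability at \<open>z\<close>. For p > 0 the domain contains
    every matrix, so the lower point found near a singular \<open>z\<close> contradicts
    minimality.\<close>
  have "det z \<noteq> 0"
  proof (cases "p < 0")
    case True
    then show ?thesis
      using z(1) by (simp add: Phi_domain_def)
  next
    case False
    show ?thesis
    proof
      assume "det z = 0"
      then obtain y where "Phi A f p y < Phi A f p z"
        using singular_not_minimum[OF lin, of p z f] False assms by auto
      then show False
        using z(2)[of y] False by (simp add: Phi_domain_def)
    qed
  qed
  then obtain D where D: "(Phi A f p has_derivative D) (at z)"
    using Phi_differentiable[OF lin] unfolding differentiable_def by blast
  have "D = (\<lambda>h. 0)"
    by (rule differential_zero_maxmin[OF z(1) open_Phi_domain D]) (use z(2) in blast)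
  then show ?thesis
    using D z(1) unfolding critical_point_on_def by blast
qed

end
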